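(* Suppose the linear-convex assumption (conditions (B1)–(B2) of the context) holds, let $t\in\{0,\ldots,K-1\}$, and let $v:\mathcal{Z}_{t+1}\to\mathbb{R}$ be bounded and measurable. Then for any fixed $x\in\mathcal{Z}_t$ the optimization problem $$\begin{aligned}\inf_{u,\gamma}\quad & r(x,u)+\sum_{s=1}^N\sum_{i=1}^{M_{t+1}}p_s\gamma_{s,i}v(x^{[i]})\\ \text{s.t.}\quad & f(x,u,\hat\xi^{[s]})=\sum_{i=1}^{M_{t+1}}\gamma_{s,i}x^{[i]}\quad\forall s\in\{1,\ldots,N\},\\ & u\in\mathcal{U}(x),\quad \gamma_s\in\Delta\quad\forall s\in\{1,\ldots,N\}\end{aligned}$$ is a convex optimization problem in the variables $(u,\gamma)$.
   Context: Setting. $K\ge1$ is an integer; $\mathcal{X}\subseteq\mathbb{R}^n$, $\mathcal{U}\subseteq\mathbb{R}^m$ are Borel sets; $\mathcal{U}(x)\subseteq\mathcal{U}$ is a nonempty Borel set for each $x\in\mathcal{X}$; $\mathcal{K}:=\{(x,u):x\in\mathcal{X},u\in\mathcal{U}(x)\}$; $\Xi=\{\hat\xi^{[1]},\ldots,\hat\xi^{[N]}\}\subset\mathbb{R}^l$ is the finite support of the disturbance $\xi$, with $p_s:=\mathrm{Prob}(\xi=\hat\xi^{[s]})$, $\sum_s p_s=1$; $f:\mathcal{X}\times\mathcal{U}\times\Xi\to\mathcal{X}$, $r:\mathcal{X}\times\mathcal{U}\to\mathbb{R}$, $q:\mathcal{X}\to\mathbb{R}$ are measurable. $\mathcal{Z}_0\subseteq\cdots\subseteq\mathcal{Z}_K\subseteq\mathcal{X}$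 are convex compact sets with $f(x,u,\boldsymbol{\xi})\in\mathcal{Z}_{t+1}$ for all $x\in\mathcal{Z}_t$, $u\in\mathcal{U}(x)$, $\boldsymbol{\xi}\in\Xi$, and $x^{[1]},\ldots,x^{[M_{t+1}]}$ are finitely many points (nodes) of $\mathcal{Z}_{t+1}$ whose convex hull is $\mathcal{Z}_{t+1}$. $\Delta:=\{\gamma\in\mathbb{R}^{M_{t+1}}:\sum_i\gamma_i=1,\gamma_i\ge0\}$. Linear-convex assumption: (B1) For each $\boldsymbol{\xi}\in\Xi$ the function $(x,u)\mapsto f(x,u,\boldsymbol{\xi})$ is affine on $\mathcal{K}$; $r$ is convex on $\mathcal{K}$; $q$ is convex on $\mathcal{X}$. (B2) If $u_{(k)}\in\mathcal{U}(x_{(k)})$ for $k=1,2$, then $\lambda u_{(1)}+(1-\lambda)u_{(2)}\in\mathcal{U}(\lambda x_{(1)}+(1-\lambda)x_{(2)})$ for any $x_{(1)},x_{(2)}\in\mathcal{X}$ and $\lambda\in(0,1)$ (in particular $\mathcal{X}$ is convex). A convex optimization problem means the minimization of a convex function over a convex feasible set, with equality constraints that are affine in the variables. *)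

theory Defs
  imports "HOL-Analysis.Analysis" "HOL-Probability.Probability_Mass_Function"
begin

text \<open>Affine maps on a convex set, in the format of \<open>convex_on\<close>; as there, convexity of the
  set is part of the notion.\<close>

definition affine_on :: "'a::real_vector set \<Rightarrow> ('a \<Rightarrow> 'b::real_vector) \<Rightarrow> bool" where
  "affine_on S g \<longleftrightarrow> convex S \<and>
    (\<forall>x\<in>S. \<forall>y\<in>S. \<forall>a\<ge>0. \<forall>b\<ge>0. a + b = 1 \<longrightarrow>
       g (a *\<^sub>R x + b *\<^sub>R y) = a *\<^sub>R g x + b *\<^sub>R g y)"

text \<open>The problem of minimizing \<open>objective z\<close> over all \<open>z \<in> ground_set\<close> subject to
  \<open>eq_lhs j z = eq_rhs j z\<close> for all \<open>j\<close>. The functions need only be meaningful on the ground set.\<close>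

record ('z, 'j, 'w) opt_problem =
  objective :: "'z \<Rightarrow> real"
  ground_set :: "'z set"
  eq_lhs :: "'j \<Rightarrow> 'z \<Rightarrow> 'w"
  eq_rhs :: "'j \<Rightarrow> 'z \<Rightarrow> 'w"

definition feasible_set :: "('z, 'j, 'w) opt_problem \<Rightarrow> 'z set" where
  "feasible_set P = {z \<in> ground_set P. \<forall>j. eq_lhs P j z = eq_rhs P j z}"

definition convex_opt_problem ::
    "('z::real_vector, 'j, 'w::real_vector) opt_problem \<Rightarrow> bool" where
  "convex_opt_problem P \<longleftrightarrow>
     convex_on (ground_set P) (objective P) \<and>
     (\<forall>j. affine_on (ground_set P) (\<lambda>z. eq_lhs P j z - eq_rhs P j z)) \<and>
     convex (feasible_set P)"

definition admissible_pairs :: "'a set \<Rightarrow> ('a \<Rightarrow> 'b set) \<Rightarrow> ('a \<times> 'b) set" where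
  "admissible_pairs X Ux = {(x, u). x \<in> X \<and> u \<in> Ux x}"

text \<open>The set-valued map \<open>Ux\<close> is meaningful on \<open>X\<close> only, so the second condition
  includes that convex combinations of points of \<open>X\<close> stay in \<open>X\<close>.\<close>

definition linear_convex ::
    "'x::real_vector set \<Rightarrow> ('x \<Rightarrow> 'u::real_vector set) \<Rightarrow> 'd set \<Rightarrow>
     ('x \<Rightarrow> 'u \<Rightarrow> 'd \<Rightarrow> 'x) \<Rightarrow> ('x \<Rightarrow> 'u \<Rightarrow> real) \<Rightarrow> ('x \<Rightarrow> real) \<Rightarrow> bool" where
  "linear_convex X Ux Xi f r q \<longleftrightarrow>
     ((\<forall>\<xi>\<in>Xi. affine_on (admissible_pairs X Ux) (\<lambda>(x, u). f x u \<xi>)) \<and>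
      convex_on (admissible_pairs X Ux) (\<lambda>(x, u). r x u) \<and>
      convex_on X q) \<and>
     (convex X \<and>
      (\<forall>x1\<in>X. \<forall>x2\<in>X. \<forall>u1\<in>Ux x1. \<forall>u2\<in>Ux x2. \<forall>c. 0 < c \<and> c < 1 \<longrightarrow>
         c *\<^sub>R u1 + (1 - c) *\<^sub>R u2 \<in> Ux (c *\<^sub>R x1 + (1 - c) *\<^sub>R x2)))"

definition prob_simplex :: "(real ^ 'i) set" where
  "prob_simplex = {\<gamma>. (\<Sum>i\<in>UNIV. \<gamma> $ i) = 1 \<and> (\<forall>i. 0 \<le> \<gamma> $ i)}"

text \<open>The decision variable is the pair \<open>(u, \<gamma>)\<close>; the row \<open>\<gamma> $ s\<close> holds the weights
  \<open>\<gamma> $ s $ i\<close> of the nodes for the disturbance value \<open>\<xi>hat s\<close>.\<close>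

definition interpolation_problem ::
    "(real ^ 'n \<Rightarrow> (real ^ 'm) set) \<Rightarrow> ('s \<Rightarrow> real ^ 'l) \<Rightarrow> ('s \<Rightarrow> real) \<Rightarrow>
     (real ^ 'n \<Rightarrow> real ^ 'm \<Rightarrow> real ^ 'l \<Rightarrow> real ^ 'n) \<Rightarrow>
     (real ^ 'n \<Rightarrow> real ^ 'm \<Rightarrow> real) \<Rightarrow> ('i \<Rightarrow> real ^ 'n) \<Rightarrow>
     (real ^ 'n \<Rightarrow> real) \<Rightarrow> real ^ 'n \<Rightarrow>
     ((real ^ 'm) \<times> (real ^ 'i ^ 's), 's, real ^ 'n) opt_problem" where
  "interpolation_problem Ux \<xi>hat p f r node v x =
     \<lparr> objective = (\<lambda>(u, \<gamma>). r x u +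
         (\<Sum>s\<in>UNIV. \<Sum>i\<in>UNIV. p s * \<gamma> $ s $ i * v (node i))),
       ground_set = {(u, \<gamma>). u \<in> Ux x \<and> (\<forall>s. \<gamma> $ s \<in> prob_simplex)},
       eq_lhs = (\<lambda>s (u, \<gamma>). f x u (\<xi>hat s)),
       eq_rhs = (\<lambda>s (u, \<gamma>). \<Sum>i\<in>UNIV. \<gamma> $ s $ i *\<^sub>R node i) \<rparr>"

end

theory Submission
  imports Defs
begin

text \<open>For fixed \<open>x\<close>, the map sending \<open>(u, \<gamma>)\<close> to
  \<open>(x, u)\<close> is affine and carries the ground set into
  \<open>admissible_pairs X Ux\<close>. Precomposition with an affine map preserves convexity and
  affinity (\<open>convex_on_compose_affine_on\<close>, \<open>affine_on_compose\<close>), so the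
  joint convexity of \<open>r\<close> and the joint affinity of \<open>f\<close> pass to the
  decision variables. Everything else is linear in \<open>\<gamma>\<close>: the expected
  interpolated value, with coefficients \<open>p s * v (node i)\<close>, and the right-hand sides,
  with coefficients \<open>node i\<close>. The ground set is convex as the product of
  \<open>Ux x\<close>, convex by (B2) at a single state, with a product of simplices. The feasible
  set is then convex as the common zero set of affine maps.\<close>

lemma affine_onD_convex: "affine_on S g \<Longrightarrow> convex S"
  by (simp add: affine_on_def)

lemma affine_onD:
  assumes "affine_on S g" "x \<in> S" "y \<in> S" "a \<ge> 0" "b \<ge> 0" "a + b = 1"
  shows "g (a *\<^sub>R x + b *\<^sub>R y) = a *\<^sub>R g x + b *\<^sub>R g y"
  using assms unfolding affine_on_def by blast

lemma linear_imp_affine_on: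
  assumes "linear g" "convex S"
  shows "affine_on S g"
  using assms by (simp add: affine_on_def linear_add linear_scale)

lemma affine_on_const_Pair:
  assumes "affine_on S g"
  shows "affine_on S (\<lambda>z. (c, g z))"
  using assms unfolding affine_on_def by (simp flip: scaleR_left_distrib)

lemma affine_on_diff:
  assumes "affine_on S g" "affine_on S h"
  shows "affine_on S (\<lambda>z. g z - h z)"
  using assms unfolding affine_on_def by (simp add: algebra_simps)

lemma affine_on_compose:
  assumes "affine_on S h" "affine_on T g" "h ` S \<subseteq> T"
  shows "affine_on S (\<lambda>z. g (h z))"
  using assms unfolding affine_on_def by (simp add: image_subset_iff)

text \<open>The map \<open>h\<close> turns a convex combination in \<open>S\<close> into the same
  combination in \<open>T\<close>, where the inequality for \<open>g\<close> applies. Convexity of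
  \<open>S\<close> comes with the affinity of \<open>h\<close>.\<close>

lemma convex_on_compose_affine_on:
  assumes "affine_on S h" "convex_on T g" "h ` S \<subseteq> T"
  shows "convex_on S (\<lambda>z. g (h z))"
  using assms unfolding affine_on_def convex_on_def by (simp add: image_subset_iff)

lemma affine_on_imp_convex_on:
  fixes g :: "'a::real_vector \<Rightarrow> real"
  assumes "affine_on S g"
  shows "convex_on S g"
  using assms unfolding affine_on_def convex_on_def by simp

text \<open>An affine map sends a convex combination of zeros to a convex combination of zero
  values.\<close>

lemma convex_zero_set_affine_on:
  assumes "\<And>j. affine_on S (g j)"
  shows "convex {z \<in> S. \<forall>j. g j z = 0}"
proof (rule convexI)
  fix y z and a b :: real
  assume yz: "y \<in> {z \<in> S. \<forall>j. g j z = 0}" "z \<in> {z \<in> S. \<forall>j. g j z = 0}"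
    and ab: "0 \<le> a" "0 \<le> b" "a + b = 1"
  have "g j (a *\<^sub>R y + b *\<^sub>R z) = 0" for j
    using affine_onD[OF assms _ _ ab] yz by simp
  \<comment> \<open>The index type is inhabited, so any single \<open>g j\<close> supplies the
    convexity of \<open>S\<close>.\<close>
  moreover have "a *\<^sub>R y + b *\<^sub>R z \<in> S"
    using convexD[OF affine_onD_convex[OF assms] _ _ ab] yz by blast
  ultimately show "a *\<^sub>R y + b *\<^sub>R z \<in> {z \<in> S. \<forall>j. g j z = 0}"
    by simp
qed

text \<open>Feasible points are the common zeros of the constraint differences, so the third clause
  of \<open>convex_opt_problem\<close> follows from the second.\<close>

lemma convex_opt_problemI:
  assumes "convex_on (ground_set P) (objective P)"
    and "\<And>j. affine_on (ground_set P) (\<lambda>z. eq_lhs P j z - eq_rhs P j z)"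
  shows "convex_opt_problem P"
  using assms convex_zero_set_affine_on[OF assms(2)]
  by (simp add: convex_opt_problem_def feasible_set_def)

lemma convex_prob_simplex: "convex prob_simplex"
  unfolding prob_simplex_def
  by (rule convexI) (simp add: sum.distrib flip: sum_distrib_left)

text \<open>Condition (B2) with both states equal to \<open>x\<close>: the combined state is again
  \<open>x\<close>, so the controls mix within \<open>Ux x\<close>.\<close>

lemma linear_convex_imp_convex_values:
  assumes "linear_convex X Ux Xi f r q" "x \<in> X"
  shows "convex (Ux x)"
proof -
  have "c *\<^sub>R u1 + (1 - c) *\<^sub>R u2 \<in> Ux (c *\<^sub>R x + (1 - c) *\<^sub>R x)"
    if "u1 \<in> Ux x" "u2 \<in> Ux x" "0 < c" "c < 1" for u1 u2 c
    using assms that unfolding linear_convex_def by blast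
  then have "c *\<^sub>R u1 + (1 - c) *\<^sub>R u2 \<in> Ux x"
    if "u1 \<in> Ux x" "u2 \<in> Ux x" "0 < c" "c < 1" for u1 u2 c
    using that by (simp flip: scaleR_left_distrib)
  \<comment> \<open>(B2) covers only weights strictly between 0 and 1; at the endpoints the
    combination is one of the two given controls. The summands are swapped to match
    \<open>convex_alt\<close>.\<close>
  then have "(1 - c) *\<^sub>R u2 + c *\<^sub>R u1 \<in> Ux x"
    if "u1 \<in> Ux x" "u2 \<in> Ux x" "0 \<le> c" "c \<le> 1" for u1 u2 c
    using that by (cases "c = 0 \<or> c = 1") (auto simp: add.commute)
  then show ?thesis
    by (simp add: convex_alt)
qed

theorem proposition3:
  fixes K t :: nat
    and X :: "(real ^ 'n) set" and U :: "(real ^ 'm) set"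
    and Ux :: "real ^ 'n \<Rightarrow> (real ^ 'm) set"
    and D :: "(real ^ 'l) pmf" and \<xi>hat :: "'s::finite \<Rightarrow> real ^ 'l" and p :: "'s \<Rightarrow> real"
    and f :: "real ^ 'n \<Rightarrow> real ^ 'm \<Rightarrow> real ^ 'l \<Rightarrow> real ^ 'n"
    and r :: "real ^ 'n \<Rightarrow> real ^ 'm \<Rightarrow> real" and q :: "real ^ 'n \<Rightarrow> real"
    and Z :: "nat \<Rightarrow> (real ^ 'n) set" and node :: "'i::finite \<Rightarrow> real ^ 'n"
    and v :: "real ^ 'n \<Rightarrow> real" and x :: "real ^ 'n"
  assumes "K \<ge> 1"
    and "X \<in> sets borel" and "U \<in> sets borel"
    and "\<And>y. y \<in> X \<Longrightarrow> Ux y \<in> sets borel \<and> Ux y \<noteq> {} \<and> Ux y \<subseteq> U"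
    and "set_pmf D = range \<xi>hat" and "\<And>s. p s = pmf D (\<xi>hat s)" and "(\<Sum>s\<in>UNIV. p s) = 1"
    and "\<And>y u \<xi>. y \<in> X \<Longrightarrow> u \<in> U \<Longrightarrow> \<xi> \<in> range \<xi>hat \<Longrightarrow> f y u \<xi> \<in> X"
    and "(\<lambda>(y, u, \<xi>). f y u \<xi>) \<in> borel_measurable (restrict_space borel (X \<times> U \<times> range \<xi>hat))"
    and "(\<lambda>(y, u). r y u) \<in> borel_measurable (restrict_space borel (X \<times> U))"
    and "q \<in> borel_measurable (restrict_space borel X)"
    and "\<And>k. k < K \<Longrightarrow> Z k \<subseteq> Z (Suc k)" and "Z K \<subseteq> X"
    and "\<And>k. k \<le> K \<Longrightarrow> convex (Z k) \<and> compact (Z k)"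
    and "\<And>k y u \<xi>. k < K \<Longrightarrow> y \<in> Z k \<Longrightarrow> u \<in> Ux y \<Longrightarrow> \<xi> \<in> range \<xi>hat \<Longrightarrow>
           f y u \<xi> \<in> Z (Suc k)"
    and "linear_convex X Ux (range \<xi>hat) f r q"
    and "t < K"
    and "range node \<subseteq> Z (Suc t)" and "convex hull (range node) = Z (Suc t)"
    and "bounded (v ` Z (Suc t))" and "v \<in> borel_measurable (restrict_space borel (Z (Suc t)))"
    and "x \<in> Z t"
  shows "convex_opt_problem (interpolation_problem Ux \<xi>hat p f r node v x)"
proof -
  let ?P = "interpolation_problem Ux \<xi>hat p f r node v x"
  let ?G = "ground_set ?P"
  let ?A = "admissible_pairs X Ux"
  note lc = \<open>linear_convex X Ux (range \<xi>hat) f r q\<close>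
  \<comment> \<open>The linear-convex assumption speaks of states in \<open>X\<close>, so
    \<open>x\<close> is carried up the nested chain to \<open>Z K\<close>, by downward induction
    from \<open>K\<close> to \<open>t\<close>.\<close>
  have "Z t \<subseteq> Z K"
    using less_imp_le[OF \<open>t < K\<close>] by (induction rule: inc_induct) (use assms(12) in blast)+
  with \<open>x \<in> Z t\<close> \<open>Z K \<subseteq> X\<close> have "x \<in> X"
    by blast
  have G: "?G = Ux x \<times> {\<gamma>. \<forall>s. \<gamma> $ s \<in> prob_simplex}"
    by (auto simp: interpolation_problem_def)
  have "convex {\<gamma> :: real ^ 'i ^ 's. \<forall>s. \<gamma> $ s \<in> prob_simplex}"
    by (rule convexI) (simp add: convexD[OF convex_prob_simplex])
  then have "convex ?G"
    unfolding G using linear_convex_imp_convex_values[OF lc \<open>x \<in> X\<close>] by (rule convex_Times[rotated])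
  \<comment> \<open>Freezing the state at \<open>x\<close> reduces the problem data to functions on
    the admissible pairs.\<close>
  have slice: "affine_on ?G (\<lambda>z. (x, fst z))"
    by (intro affine_on_const_Pair linear_imp_affine_on linear_fst \<open>convex ?G\<close>)
  have slice_sub: "(\<lambda>z. (x, fst z)) ` ?G \<subseteq> ?A"
    using \<open>x \<in> X\<close> by (auto simp: G admissible_pairs_def)
  show ?thesis
  proof (rule convex_opt_problemI)
    have "convex_on ?A (\<lambda>(y, u). r y u)"
      using lc by (simp add: linear_convex_def)
    from convex_on_compose_affine_on[OF slice this slice_sub]
    have "convex_on ?G (\<lambda>z. r x (fst z))"
      by simp
    \<comment> \<open>The values \<open>v (node i)\<close> are fixed numbers, so this term is linear
      in \<open>\<gamma>\<close> and hence convex whatever their signs.\<close>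
    moreover have "linear (\<lambda>z. \<Sum>s\<in>UNIV. \<Sum>i\<in>UNIV. p s * (snd z :: real ^ 'i ^ 's) $ s $ i * v (node i))"
      by (intro linearI) (simp_all add: algebra_simps sum.distrib sum_distrib_left)
    ultimately show "convex_on ?G (objective ?P)"
      using convex_on_add[OF _ affine_on_imp_convex_on[OF linear_imp_affine_on[OF _ \<open>convex ?G\<close>]]]
      by (simp add: interpolation_problem_def case_prod_beta')
  next
    fix s
    have "affine_on ?A (\<lambda>(y, u). f y u (\<xi>hat s))"
      using lc by (simp add: linear_convex_def)
    from affine_on_compose[OF slice this slice_sub]
    have "affine_on ?G (\<lambda>z. f x (fst z) (\<xi>hat s))"
      by simp
    \<comment> \<open>With the nodes fixed, the interpolated successor state is linear in the
      weights, so each constraint difference is affine minus linear.\<close>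
    moreover have "linear (\<lambda>z. \<Sum>i\<in>UNIV. (snd z :: real ^ 'i ^ 's) $ s $ i *\<^sub>R node i)"
      by (intro linearI) (simp_all add: algebra_simps sum.distrib scaleR_sum_right)
    ultimately show "affine_on ?G (\<lambda>z. eq_lhs ?P s z - eq_rhs ?P s z)"
      using affine_on_diff[OF _ linear_imp_affine_on[OF _ \<open>convex ?G\<close>]]
      by (simp add: interpolation_problem_def case_prod_beta')
  qed
qed

end
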